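(* Let $R$ be a nontrivial commutative ring with identity such that $|Z(R)^{\star}|>1$. If the graph $\widetilde{\Gamma}(R)$ is not complete, then $\mathrm{diam}(\Gamma(R))=3$.
   Context: $Z(R)$ is the set of zero-divisors of $R$ (including $0$) and $Z(R)^{\star}=Z(R)\setminus\{0\}$. The zero-divisor graph $\Gamma(R)$ is the undirected simple graph with vertex set $Z(R)^{\star}$ in which distinct $x,y$ are adjacent if and only if $xy=0$. The graph $\widetilde{\Gamma}(R)$ is the undirected simple graph with vertex set $Z(R)^{\star}$ in which distinct $x,y$ are adjacent if and only if $xy=0$ or $x+y\in Z(R)$. A graph is complete if each pair of distinct vertices forms an edge. The distance between two vertices is the least length (number of edges) of a path joining them ($\infty$ if there is none), and the diameter $\mathrm{diam}$ of a graph is the greatest distance between two vertices. *)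

theory Defs
  imports
    "HOL-Algebra.Ring"
    "HOL-Library.Extended_Nat"
    "Graph_Theory.Pair_Digraph"
begin

definition zero_divisors :: "('a, 'm) ring_scheme \<Rightarrow> 'a set"
  where "zero_divisors R =
    {x \<in> carrier R. \<exists>y \<in> carrier R. y \<noteq> \<zero>\<^bsub>R\<^esub> \<and> x \<otimes>\<^bsub>R\<^esub> y = \<zero>\<^bsub>R\<^esub>}"

definition nonzero_zero_divisors :: "('a, 'm) ring_scheme \<Rightarrow> 'a set"
  where "nonzero_zero_divisors R = zero_divisors R - {\<zero>\<^bsub>R\<^esub>}"

text \<open>An undirected simple graph is encoded as a symmetric loop-free pair digraph: the edge
  between \<open>x\<close> and \<open>y\<close> is represented by both arcs \<open>(x, y)\<close> and \<open>(y, x)\<close>. The graphs need not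
  be finite.\<close>

definition zero_divisor_graph :: "('a, 'm) ring_scheme \<Rightarrow> 'a pair_pre_digraph"
  where "zero_divisor_graph R =
    \<lparr>pverts = nonzero_zero_divisors R,
     parcs = {(x, y). x \<in> nonzero_zero_divisors R \<and> y \<in> nonzero_zero_divisors R \<and> x \<noteq> y \<and>
       x \<otimes>\<^bsub>R\<^esub> y = \<zero>\<^bsub>R\<^esub>}\<rparr>"

definition extended_zero_divisor_graph :: "('a, 'm) ring_scheme \<Rightarrow> 'a pair_pre_digraph"
  where "extended_zero_divisor_graph R =
    \<lparr>pverts = nonzero_zero_divisors R,
     parcs = {(x, y). x \<in> nonzero_zero_divisors R \<and> y \<in> nonzero_zero_divisors R \<and> x \<noteq> y \<and>
       (x \<otimes>\<^bsub>R\<^esub> y = \<zero>\<^bsub>R\<^esub> \<or> x \<oplus>\<^bsub>R\<^esub> y \<in> zero_divisors R)}\<rparr>"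

text \<open>The library predicate \<open>complete_digraph\<close> only covers finite graphs.\<close>

definition complete_graph :: "'a pair_pre_digraph \<Rightarrow> bool"
  where "complete_graph G \<longleftrightarrow>
    (\<forall>u \<in> pverts G. \<forall>v \<in> pverts G. u \<noteq> v \<longrightarrow> (u, v) \<in> parcs G)"

context pre_digraph
begin

text \<open>A path is the list of its arcs, so its length is the number of edges. The infimum of the
  empty set in \<^typ>\<open>enat\<close> is \<open>\<infinity>\<close>.\<close>

definition distance :: "'a \<Rightarrow> 'a \<Rightarrow> enat"
  where "distance u v = (INF p \<in> {p. apath u p v}. enat (length p))"

text \<open>The supremum in \<^typ>\<open>enat\<close> is the greatest distance whenever it is finite.\<close>

definition diameter :: enat
  where "diameter = (SUP u \<in> verts G. SUP v \<in> verts G. distance u v)"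

end

lemma zero_divisor_graph_bidirected:
  assumes "cring R"
  shows "pair_bidirected_digraph (zero_divisor_graph R)"
proof -
  interpret cring R by fact
  have "x \<in> carrier R" if "x \<in> nonzero_zero_divisors R" for x
    using that by (auto simp: nonzero_zero_divisors_def zero_divisors_def)
  then show ?thesis
    by unfold_locales
      (auto simp: zero_divisor_graph_def symmetric_def intro!: symI intro: m_comm[THEN trans])
qed

lemma extended_zero_divisor_graph_bidirected:
  assumes "cring R"
  shows "pair_bidirected_digraph (extended_zero_divisor_graph R)"
proof -
  interpret cring R by fact
  have "x \<in> carrier R" if "x \<in> nonzero_zero_divisors R" for x
    using that by (auto simp: nonzero_zero_divisors_def zero_divisors_def)
  then show ?thesis
    by unfold_locales
      (auto simp: extended_zero_divisor_graph_def symmetric_def a_comm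
        intro!: symI intro: m_comm[THEN trans])
qed

end

theory Submission
  imports Defs
begin

text \<open>Non-completeness yields zero-divisors \<open>x \<noteq> y\<close> with \<open>x y \<noteq> 0\<close> and \<open>x + y\<close> regular.
  These two vertices are at distance at least \<open>3\<close> in the zero-divisor graph: they are not
  adjacent, and a common neighbour \<open>z\<close> would satisfy \<open>(x + y) z = x z + y z = 0\<close>, against the
  regularity of \<open>x + y\<close>.

  Conversely, no zero-divisor graph has diameter above \<open>3\<close>. Given vertices \<open>u\<close> and \<open>v\<close>, choose
  nonzero annihilators \<open>a\<close> of \<open>u\<close> and \<open>b\<close> of \<open>v\<close>. If \<open>a b = 0\<close>, then \<open>u, a, b, v\<close> is a walk;
  otherwise \<open>a b\<close> kills both \<open>u\<close> and \<open>v\<close>, and \<open>u, a b, v\<close> is one. Consecutive entries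
  may coincide, and loops are not arcs; the argument therefore counts distances rather than
  arcs, because \<open>s t = 0\<close> gives \<open>d(s, t) \<le> 1\<close> even for \<open>s = t\<close>, and the triangle inequality
  adds these bounds.\<close>

text \<open>A walk is turned into a path by repeatedly cutting out a closed subwalk.\<close>

lemma (in wf_digraph) length_awalk_to_apath_le:
  assumes "awalk u p v"
  shows "length (awalk_to_apath p) \<le> length p"
  using assms
proof (induct rule: awalk_to_apath_induct)
  case (path p)
  then have "awalk_to_apath p = p"
    by (auto simp: awalk_to_apath.simps)
  then show ?case by simp
next
  case (decomp p q r s)
  then have "length (q @ s) \<le> length p"
    by (auto elim!: awalk_cyc_decompE)
  then show ?case
    using decomp step_awalk_to_apath[of _ p _ q r s] by simp
qed

text \<open>Distance is an infimum over paths, but a walk is enough to bound it from above.\<close>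

lemma (in wf_digraph) distance_le_length_awalk:
  assumes "awalk u p v"
  shows "distance u v \<le> enat (length p)"
proof -
  have "length (awalk_to_apath p) \<le> length p"
    using assms by (rule length_awalk_to_apath_le)
  moreover have "apath u (awalk_to_apath p) v"
    using assms by (rule apath_awalk_to_apath)
  ultimately show ?thesis
    unfolding distance_def by (intro INF_lower2) auto
qed

lemma (in pre_digraph) distance_attained:
  assumes "distance u v \<noteq> \<infinity>"
  obtains p where "apath u p v" "distance u v = enat (length p)"
proof -
  have "{p. apath u p v} \<noteq> {}"
    using assms by (auto simp: distance_def top_enat_def[symmetric])
  then have "(INF p \<in> {p. apath u p v}. enat (length p)) \<in> (\<lambda>p. enat (length p)) ` {p. apath u p v}"
    unfolding Inf_enat_def by (auto intro: LeastI)
  then show thesis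
    using that by (auto simp: distance_def)
qed

text \<open>Joining two shortest paths gives a walk that need not be a path, which is why distances
  are first bounded by lengths of walks.\<close>

lemma (in wf_digraph) distance_triangle:
  "distance u w \<le> distance u v + distance v w"
proof (cases "distance u v = \<infinity> \<or> distance v w = \<infinity>")
  case False
  obtain p where p: "apath u p v" "distance u v = enat (length p)"
    using False distance_attained[of u v] by blast
  obtain q where q: "apath v q w" "distance v w = enat (length q)"
    using False distance_attained[of v w] by blast
  have "awalk u (p @ q) w"
    using p(1) q(1) by (blast intro: awalk_appendI awalkI_apath)
  from distance_le_length_awalk[OF this] show ?thesis
    using p(2) q(2) by simp
qed auto

lemma nonzero_zero_divisors_iff:
  "x \<in> nonzero_zero_divisors R \<longleftrightarrow> x \<in> carrier R \<and> x \<noteq> \<zero>\<^bsub>R\<^esub> \<and>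
    (\<exists>y \<in> carrier R. y \<noteq> \<zero>\<^bsub>R\<^esub> \<and> x \<otimes>\<^bsub>R\<^esub> y = \<zero>\<^bsub>R\<^esub>)"
  by (auto simp: nonzero_zero_divisors_def zero_divisors_def)

lemma verts_zero_divisor_graph:
  "verts (with_proj (zero_divisor_graph R)) = nonzero_zero_divisors R"
  by (simp add: zero_divisor_graph_def)

lemma arcs_zero_divisor_graph:
  "arcs (with_proj (zero_divisor_graph R)) =
    {(x, y). x \<in> nonzero_zero_divisors R \<and> y \<in> nonzero_zero_divisors R \<and> x \<noteq> y \<and>
      x \<otimes>\<^bsub>R\<^esub> y = \<zero>\<^bsub>R\<^esub>}"
  by (simp add: zero_divisor_graph_def)

context cring
begin

lemma wf_zero_divisor_graph: "wf_digraph (with_proj (zero_divisor_graph R))"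
proof -
  interpret pair_bidirected_digraph "zero_divisor_graph R"
    by (rule zero_divisor_graph_bidirected) (rule is_cring)
  show ?thesis by unfold_locales
qed

text \<open>Allowing \<open>s = t\<close>, where the distance is \<open>0\<close>, spares every later use a case distinction on
  coinciding vertices.\<close>

lemma zero_divisor_graph_distance_le_1:
  assumes "s \<in> nonzero_zero_divisors R" "t \<in> nonzero_zero_divisors R" "s \<otimes> t = \<zero>"
  shows "pre_digraph.distance (with_proj (zero_divisor_graph R)) s t \<le> 1"
proof -
  interpret G: wf_digraph "with_proj (zero_divisor_graph R)"
    by (rule wf_zero_divisor_graph)
  show ?thesis
  proof (cases "s = t")
    case True
    have "G.awalk s [] s"
      using assms(1) by (simp add: G.awalk_Nil_iff verts_zero_divisor_graph del: with_proj_simps(1))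
    from G.distance_le_length_awalk[OF this] True show ?thesis
      by (simp add: zero_enat_def[symmetric])
  next
    case False
    have "G.awalk s [(s, t)] t"
      using assms False by (simp add: G.awalk_Cons_iff G.awalk_Nil_iff
          verts_zero_divisor_graph arcs_zero_divisor_graph del: with_proj_simps(1,2))
    from G.distance_le_length_awalk[OF this] show ?thesis
      by (simp add: one_enat_def)
  qed
qed

text \<open>The annihilators \<open>a\<close> of \<open>u\<close> and \<open>b\<close> of \<open>v\<close> are joined to each other if \<open>a b = 0\<close>, and
  otherwise their product is a nonzero common annihilator of \<open>u\<close> and \<open>v\<close>.\<close>

lemma zero_divisor_graph_distance_le_3:
  assumes u: "u \<in> nonzero_zero_divisors R" and v: "v \<in> nonzero_zero_divisors R"
  shows "pre_digraph.distance (with_proj (zero_divisor_graph R)) u v \<le> 3"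
proof -
  interpret G: wf_digraph "with_proj (zero_divisor_graph R)"
    by (rule wf_zero_divisor_graph)
  have vertex: "c \<in> nonzero_zero_divisors R"
    if "c \<in> carrier R" "c \<noteq> \<zero>" "w \<in> nonzero_zero_divisors R" "c \<otimes> w = \<zero>" for c w
    using that by (auto simp: nonzero_zero_divisors_iff)
  have carr: "u \<in> carrier R" "v \<in> carrier R"
    using u v by (auto simp: nonzero_zero_divisors_iff)
  obtain a where a: "a \<in> carrier R" "a \<noteq> \<zero>" "u \<otimes> a = \<zero>"
    using u by (auto simp: nonzero_zero_divisors_iff)
  obtain b where b: "b \<in> carrier R" "b \<noteq> \<zero>" "b \<otimes> v = \<zero>"
    using v carr by (auto simp: nonzero_zero_divisors_iff m_comm)
  have av: "a \<in> nonzero_zero_divisors R" and bv: "b \<in> nonzero_zero_divisors R"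
    using vertex[OF a(1,2) u] vertex[OF b(1,2) v b(3)] a carr by (auto simp: m_comm)
  show ?thesis
  proof (cases "a \<otimes> b = \<zero>")
    case True
    have "G.distance u v \<le> G.distance u a + (G.distance a b + G.distance b v)"
      by (meson G.distance_triangle add_left_mono order_trans)
    also have "\<dots> \<le> 1 + (1 + 1)"
      using a b u v av bv True
      by (intro add_mono zero_divisor_graph_distance_le_1)
    finally show ?thesis by (simp add: numeral_3_eq_3 one_enat_def numeral_eq_enat)
  next
    case False
    have ab: "u \<otimes> (a \<otimes> b) = \<zero>" "(a \<otimes> b) \<otimes> v = \<zero>"
      using a b carr by (simp_all add: m_assoc flip: m_assoc[of u])
    have abv: "a \<otimes> b \<in> nonzero_zero_divisors R"
      using vertex[OF _ False v ab(2)] a b by simp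
    have "G.distance u v \<le> G.distance u (a \<otimes> b) + G.distance (a \<otimes> b) v"
      by (rule G.distance_triangle)
    also have "\<dots> \<le> 1 + 1"
      using u v abv ab by (intro add_mono zero_divisor_graph_distance_le_1)
    also have "(1 + 1 :: enat) \<le> 3"
      by (simp add: one_enat_def numeral_eq_enat)
    finally show ?thesis .
  qed
qed

text \<open>An element that kills both \<open>x\<close> and \<open>y\<close> kills their sum, so a regular sum leaves no room for
  a path of length \<open>2\<close>.\<close>

lemma zero_divisor_graph_distance_ge_3:
  assumes x: "x \<in> nonzero_zero_divisors R" and y: "y \<in> nonzero_zero_divisors R"
    and "x \<noteq> y" "x \<otimes> y \<noteq> \<zero>" "x \<oplus> y \<notin> zero_divisors R"
  shows "3 \<le> pre_digraph.distance (with_proj (zero_divisor_graph R)) x y"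
proof -
  interpret G: wf_digraph "with_proj (zero_divisor_graph R)"
    by (rule wf_zero_divisor_graph)
  have no_common: False
    if "z \<in> nonzero_zero_divisors R" "x \<otimes> z = \<zero>" "z \<otimes> y = \<zero>" for z
  proof -
    have carr: "x \<in> carrier R" "y \<in> carrier R" "z \<in> carrier R" "z \<noteq> \<zero>"
      using x y that by (auto simp: nonzero_zero_divisors_iff)
    have "(x \<oplus> y) \<otimes> z = \<zero>"
      using that carr by (simp add: l_distr m_comm[of y])
    then have "x \<oplus> y \<in> zero_divisors R"
      using carr by (auto simp: zero_divisors_def)
    with assms(5) show False ..
  qed
  have "3 \<le> length p" if "G.apath x p y" for p
  proof (rule ccontr)
    assume "\<not> 3 \<le> length p"
    then consider "p = []" | e where "p = [e]" | e f where "p = [e, f]"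
      by (cases p rule: list.exhaust[case_product list.exhaust])
        (auto simp: not_le numeral_3_eq_3 less_Suc_eq length_Suc_conv)
    then show False
      using that assms(3,4) no_common
      by cases (auto simp: G.apath_def G.awalk_Cons_iff G.awalk_Nil_iff
          verts_zero_divisor_graph arcs_zero_divisor_graph simp del: with_proj_simps(1,2))
  qed
  then show ?thesis
    unfolding G.distance_def by (intro INF_greatest) (simp add: numeral_eq_enat)
qed

end

theorem theorem1p4:
  fixes R :: "('a, 'm) ring_scheme"
  assumes "cring R"
    and "\<one>\<^bsub>R\<^esub> \<noteq> \<zero>\<^bsub>R\<^esub>"
    and "infinite (nonzero_zero_divisors R) \<or> card (nonzero_zero_divisors R) > 1"
    and "\<not> complete_graph (extended_zero_divisor_graph R)"
  shows "pre_digraph.diameter (with_proj (zero_divisor_graph R)) = 3"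
proof -
  interpret cring R by fact
  obtain x y where xy: "x \<in> nonzero_zero_divisors R" "y \<in> nonzero_zero_divisors R"
    "x \<noteq> y" "x \<otimes>\<^bsub>R\<^esub> y \<noteq> \<zero>\<^bsub>R\<^esub>" "x \<oplus>\<^bsub>R\<^esub> y \<notin> zero_divisors R"
    using assms(4) by (auto simp: complete_graph_def extended_zero_divisor_graph_def)
  show ?thesis
    unfolding pre_digraph.diameter_def verts_zero_divisor_graph
  proof (rule antisym)
    show "(SUP u \<in> nonzero_zero_divisors R. SUP v \<in> nonzero_zero_divisors R.
        pre_digraph.distance (with_proj (zero_divisor_graph R)) u v) \<le> 3"
      by (intro SUP_least zero_divisor_graph_distance_le_3)
    show "3 \<le> (SUP u \<in> nonzero_zero_divisors R. SUP v \<in> nonzero_zero_divisors R.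
        pre_digraph.distance (with_proj (zero_divisor_graph R)) u v)"
      by (rule SUP_upper2[OF xy(1)], rule SUP_upper2[OF xy(2)])
        (rule zero_divisor_graph_distance_ge_3[OF xy])
  qed
qed

end
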